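(* Let $\mathbb{F}$ be an algebraically closed field and let $\mathcal{Z}(x)=\sum_{n=0}^\infty z(n)x^n=\prod_{k=1}^\infty\frac{1}{1-p(k)x^k}$ be the generating function of the numbers $z(n)$ of $z$-classes of linear maps on $n$-dimensional $\mathbb{F}$-vector spaces. Then $\mathcal{Z}(x)$ is a meromorphic function on the unit disc $\{x\in\mathbb{C}: |x|<1\}$, and it cannot be extended (meromorphically) beyond the unit disc.
   Context: For an $n$-dimensional $\mathbb{F}$-vector space $\mathbb{V}$, $GL(\mathbb{V})$ acts by conjugation on the set $L(\mathbb{V})$ of all linear maps $\mathbb{V}\to\mathbb{V}$. Two elements of $L(\mathbb{V})$ are $z$-equivalent if their centralizers in $GL(\mathbb{V})$ are conjugate in $GL(\mathbb{V})$; $z(n)$ is the number of equivalence classes ($z$-classes), with $z(0)=1$. $p(k)$ denotes the number of partitions of $k$. The formula $\sum z(n)x^n=\prod_k (1-p(k)x^k)^{-1}$ is the expression for $\mathcal{Z}(x)$ as a formal power series used in the paper; the function meant is the one defined by the product.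
   Formalization: Z(x) is taken to be the product ∏1/(1−p(k)x^k) alone; the equality with Σz(n)x^n is dropped because it is false: z(4) ≤ 14, while the product's x^4 coefficient is 15. The field and the z-classes do not appear. *)

theory Defs
  imports
    "HOL-Complex_Analysis.Complex_Analysis"
    "HOL-Library.Multiset"
begin

text \<open>
  A partition of \<open>k\<close> is a finite multiset of positive integers with sum \<open>k\<close>.
\<close>

definition num_partitions :: "nat \<Rightarrow> nat" where
  "num_partitions k = card {P :: nat multiset. 0 \<notin># P \<and> sum_mset P = k}"

text \<open>
  The function is the one given by the product.  Its Taylor coefficients at \<open>0\<close> are not in
  general the numbers of conjugacy classes of centralizers of \<open>n \<times> n\<close> matrices over an
  algebraically closed field: those are counted by multisets of partitions of total size \<open>n\<close>
  (14 for \<open>n = 4\<close>), whereas the coefficient of \<open>x ^ 4\<close> below is 15, because the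
  product distinguishes the orderings of partitions of the same size.

  The product over \<open>k \<ge> 1\<close> is indexed by \<open>k + 1\<close> with \<open>k \<ge> 0\<close>.  At a pole, i.e. where
  some factor has denominator \<open>0\<close>, that factor is \<open>0\<close> by the convention \<open>1 / 0 = 0\<close>; this
  only affects the (irrelevant) value of the function at the pole itself.  Outside the open
  unit disc the product need not converge and the value there carries no meaning.
\<close>

definition gen_fun_Z :: "complex \<Rightarrow> complex" where
  "gen_fun_Z x = (\<Prod>k. 1 / (1 - of_nat (num_partitions (Suc k)) * x ^ Suc k))"

end

theory Submission
  imports Defs
begin

text \<open>
  On the unit disc the function is the reciprocal of
  \<open>h(x) = (\<Prod>k\<ge>1. 1 - p(k) x^k)\<close>.  This product converges locally uniformly because
  \<open>\<Sum>k. p(k) r^k\<close> converges for every \<open>r < 1\<close>: its partial sums are bounded by the finite Euler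
  products \<open>\<Prod>i\<le>m. 1 / (1 - r^i)\<close>, which stay bounded as \<open>m\<close> grows
  (\<open>summable_num_partitions\<close>).  So \<open>h\<close> is holomorphic with \<open>h(0) = 1\<close>, and \<open>1 / h\<close> is meromorphic
  with a pole at every zero of \<open>h\<close>.

  The zeros of the \<open>k\<close>-th factor are the numbers \<open>p(k) powr (-1/k) * \<zeta>\<close> with \<open>\<zeta>^k = 1\<close>.  They lie
  inside the disc for \<open>k \<ge> 2\<close>, since then \<open>p(k) \<ge> 2\<close>.  Summability forces \<open>p(k) r^k < 1\<close> eventually,
  so the radii tend to \<open>1\<close>, while the \<open>k\<close>-th roots of unity become dense in the circle.  Hence the
  poles accumulate at every point of the unit circle (\<open>zeros_accumulate_at_circle\<close>).  A connected
  open set strictly larger than the disc contains a point of the circle, and a function meromorphic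
  there would have no poles in some punctured neighbourhood of that point.
\<close>

section \<open>Growth of the partition numbers\<close>

definition partitions_le :: "nat \<Rightarrow> nat \<Rightarrow> nat multiset set" where
  "partitions_le m k = {P. set_mset P \<subseteq> {1..m} \<and> sum_mset P = k}"

text \<open>
  Either the part \<open>m + 1\<close> does not occur, or one copy of it can be removed.
\<close>

lemma partitions_le_Suc:
  "partitions_le (Suc m) k = partitions_le m k \<union>
     (if Suc m \<le> k then add_mset (Suc m) ` partitions_le (Suc m) (k - Suc m) else {})"
  (is "?L = ?R")
proof
  show "?L \<subseteq> ?R"
  proof
    fix P assume P: "P \<in> ?L"
    show "P \<in> ?R"
    proof (cases "Suc m \<in># P")
      case False
      then have "set_mset P \<subseteq> {1..m}"
        using P by (auto simp: partitions_le_def subset_iff le_Suc_eq)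
      then show ?thesis using P by (auto simp: partitions_le_def)
    next
      case True
      then obtain Q where Q: "P = add_mset (Suc m) Q" by (meson multi_member_split)
      then have "Q \<in> partitions_le (Suc m) (k - Suc m)" "Suc m \<le> k"
        using P by (auto simp: partitions_le_def)
      then show ?thesis using Q by auto
    qed
  qed
next
  show "?R \<subseteq> ?L"
    by (auto simp: partitions_le_def subset_iff split: if_splits)
qed

lemma partitions_le_0: "partitions_le 0 k = (if k = 0 then {{#}} else {})"
  by (auto simp: partitions_le_def)

lemma finite_partitions_le: "finite (partitions_le m k)"
proof (induction m arbitrary: k)
  case 0
  then show ?case by (simp add: partitions_le_0)
next
  case (Suc m)
  show ?case
  proof (induction k rule: less_induct)
    case (less k)
    then show ?case
      using Suc.IH by (subst partitions_le_Suc) auto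
  qed
qed

lemma num_partitions_eq_card_partitions_le:
  assumes "k \<le> m"
  shows "num_partitions k = card (partitions_le m k)"
proof -
  have "x \<le> sum_mset P" if "x \<in># P" for x and P :: "nat multiset"
    using that by (metis le_add1 multi_member_split sum_mset.add_mset)
  then have "{P :: nat multiset. 0 \<notin># P \<and> sum_mset P = k} = partitions_le m k"
    using assms by (fastforce simp: partitions_le_def subset_iff Suc_le_eq intro!: gr0I)
  then show ?thesis by (simp add: num_partitions_def)
qed

text \<open>
  The partial sum on the left is dominated by the Euler product \<open>\<Prod>i=1..m. 1 / (1 - r^i)\<close>: with
  \<open>S m\<close> denoting the sum, the recursion for \<open>partitions_le\<close> gives
  \<open>S (m + 1) \<le> S m + r^(m + 1) * S (m + 1)\<close>.
  Then \<open>1 / (1 - y) = 1 + y / (1 - y) \<le> exp (y / (1 - y))\<close> turns the product into a geometric sum.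
\<close>

lemma sum_card_partitions_le_bound:
  fixes r :: real
  assumes r: "0 \<le> r" "r < 1"
  shows "(\<Sum>k\<le>N. real (card (partitions_le m k)) * r ^ k) \<le> exp ((\<Sum>i=1..m. r ^ i) / (1 - r))"
proof (induction m)
  case 0
  have "(\<Sum>k\<le>N. real (card (partitions_le 0 k)) * r ^ k) = (\<Sum>k\<le>N. if k = 0 then 1 else 0)"
    by (intro sum.cong) (auto simp: partitions_le_0)
  then show ?case by simp
next
  case (Suc m)
  define c where "c = (\<lambda>k. real (card (partitions_le (Suc m) k)))"
  define S where "S = (\<Sum>k\<le>N. c k * r ^ k)"
  define y where "y = r ^ Suc m"
  have y: "0 \<le> y" "y \<le> r" "y < 1"
    using r power_decreasing[of 1 "Suc m" r] by (auto simp: y_def power_Suc_less_one simp del: power_Suc)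
  have c_le: "c k \<le> real (card (partitions_le m k)) + (if Suc m \<le> k then c (k - Suc m) else 0)" for k
  proof -
    have "card (partitions_le (Suc m) k) \<le> card (partitions_le m k) +
        card (if Suc m \<le> k then add_mset (Suc m) ` partitions_le (Suc m) (k - Suc m) else {})"
      by (subst partitions_le_Suc) (rule card_Un_le)
    also have "\<dots> \<le> card (partitions_le m k) +
        (if Suc m \<le> k then card (partitions_le (Suc m) (k - Suc m)) else 0)"
      by (auto intro: card_image_le finite_partitions_le)
    finally show ?thesis unfolding c_def by (auto split: if_splits)
  qed
  have "(\<Sum>k\<le>N. (if Suc m \<le> k then c (k - Suc m) else 0) * r ^ k) =
        (\<Sum>k\<in>{Suc m..N}. c (k - Suc m) * r ^ k)"
    by (rule sum.mono_neutral_cong_right) auto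
  also have "\<dots> = (\<Sum>j\<in>(\<lambda>k. k - Suc m) ` {Suc m..N}. y * (c j * r ^ j))"
    by (subst sum.reindex) (auto simp: inj_on_def y_def power_add[symmetric] simp del: power_Suc intro!: sum.cong)
  also have "\<dots> \<le> (\<Sum>j\<le>N. y * (c j * r ^ j))"
    by (rule sum_mono2) (use y r in \<open>auto simp: c_def\<close>)
  finally have shifted: "(\<Sum>k\<le>N. (if Suc m \<le> k then c (k - Suc m) else 0) * r ^ k) \<le> y * S"
    by (simp add: S_def sum_distrib_left)
  have "S \<le> (\<Sum>k\<le>N. (real (card (partitions_le m k)) +
                       (if Suc m \<le> k then c (k - Suc m) else 0)) * r ^ k)"
    unfolding S_def by (intro sum_mono mult_right_mono c_le) (use r in auto)
  also have "\<dots> \<le> exp ((\<Sum>i=1..m. r ^ i) / (1 - r)) + y * S"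
    using Suc.IH shifted by (simp add: distrib_right sum.distrib)
  finally have "S * (1 - y) \<le> exp ((\<Sum>i=1..m. r ^ i) / (1 - r))"
    by (simp add: algebra_simps)
  then have "S \<le> exp ((\<Sum>i=1..m. r ^ i) / (1 - r)) * (1 / (1 - y))"
    using y by (simp add: field_simps)
  also have "1 / (1 - y) = 1 + y / (1 - y)"
    using y by (simp add: field_simps)
  also have "\<dots> \<le> exp (y / (1 - y))" by (rule exp_ge_add_one_self)
  also have "y / (1 - y) \<le> y / (1 - r)"
    using y r by (intro divide_left_mono) auto
  finally have "S \<le> exp ((\<Sum>i=1..m. r ^ i) / (1 - r)) * exp (y / (1 - r))"
    by (simp add: mult_left_mono)
  also have "\<dots> = exp ((\<Sum>i=1..Suc m. r ^ i) / (1 - r))"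
    by (simp add: exp_add[symmetric] add_divide_distrib y_def)
  finally show ?case unfolding S_def c_def .
qed

lemma summable_num_partitions:
  fixes r :: real
  assumes r: "0 \<le> r" "r < 1"
  shows "summable (\<lambda>k. real (num_partitions k) * r ^ k)"
proof (rule summableI_nonneg_bounded)
  fix N
  have "(\<Sum>k<N. real (num_partitions k) * r ^ k) \<le> (\<Sum>k\<le>N. real (num_partitions k) * r ^ k)"
    by (rule sum_mono2) (use r in auto)
  also have "\<dots> = (\<Sum>k\<le>N. real (card (partitions_le N k)) * r ^ k)"
    by (intro sum.cong) (auto simp: num_partitions_eq_card_partitions_le[of _ N])
  also have "\<dots> \<le> exp ((\<Sum>i=1..N. r ^ i) / (1 - r))"
    by (rule sum_card_partitions_le_bound[OF r])
  also have "\<dots> \<le> exp ((1 / (1 - r)) / (1 - r))"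
  proof -
    have "(\<Sum>i=1..N. r ^ i) \<le> (\<Sum>i. r ^ i)"
      by (rule sum_le_suminf) (use r in auto)
    also have "\<dots> = 1 / (1 - r)" using r by (intro suminf_geometric) auto
    finally show ?thesis
      unfolding exp_le_cancel_iff by (rule divide_right_mono) (use r in auto)
  qed
  finally show "(\<Sum>k<N. real (num_partitions k) * r ^ k) \<le> exp ((1 / (1 - r)) / (1 - r))" .
qed (use r in auto)

lemma num_partitions_ge_2:
  assumes "k \<ge> 2"
  shows "num_partitions k \<ge> 2"
proof -
  have "card {{#k#}, {#k - 1, 1#}} \<le> card (partitions_le k k)"
    by (rule card_mono[OF finite_partitions_le]) (use assms in \<open>auto simp: partitions_le_def\<close>)
  then show ?thesis
    by (simp add: num_partitions_eq_card_partitions_le[of k k])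
qed

section \<open>The reciprocal function\<close>

definition recip_Z :: "complex \<Rightarrow> complex" where
  "recip_Z x = (\<Prod>k. 1 - of_nat (num_partitions (Suc k)) * x ^ Suc k)"

lemma convergent_prod_recip_Z:
  fixes x :: complex
  assumes "norm x < 1"
  shows "convergent_prod (\<lambda>k. 1 - of_nat (num_partitions (Suc k)) * x ^ Suc k)"
proof -
  have "summable (\<lambda>k. real (num_partitions (Suc k)) * norm x ^ Suc k)"
    using summable_num_partitions[of "norm x"] assms by (subst summable_Suc_iff) auto
  then show ?thesis
    by (intro abs_convergent_prod_imp_convergent_prod summable_imp_abs_convergent_prod)
       (simp add: norm_mult norm_power)
qed

lemma gen_fun_Z_eq_inverse_recip_Z: "norm x < 1 \<Longrightarrow> gen_fun_Z x = inverse (recip_Z x)"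
  unfolding gen_fun_Z_def recip_Z_def
  by (subst prodinf_inverse[OF convergent_prod_recip_Z, symmetric]) (simp_all add: divide_inverse)

lemma recip_Z_eq_0_iff:
  assumes "norm x < 1"
  shows "recip_Z x = 0 \<longleftrightarrow> (\<exists>k>0. of_nat (num_partitions k) * x ^ k = 1)"
proof -
  have "(\<lambda>k. 1 - of_nat (num_partitions (Suc k)) * x ^ Suc k) has_prod recip_Z x"
    unfolding recip_Z_def by (rule convergent_prod_has_prod[OF convergent_prod_recip_Z[OF assms]])
  from has_prod_eq_0_iff[OF this] show ?thesis
    by (auto simp: image_iff gr0_conv_Suc simp del: power_Suc)
qed

lemma recip_Z_0: "recip_Z 0 = 1"
  by (simp add: recip_Z_def)

lemma holomorphic_recip_Z: "recip_Z holomorphic_on ball 0 1"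
proof (rule holomorphic_uniform_sequence)
  fix x :: complex assume x: "x \<in> ball 0 1"
  then obtain d where d: "d > 0" "cball x d \<subseteq> ball 0 1"
    using open_contains_cball by (metis open_ball)
  \<comment> \<open>the point of largest modulus supplies the radius for a summable majorant on the whole disc\<close>
  obtain a where a: "a \<in> cball x d" "\<And>y. y \<in> cball x d \<Longrightarrow> norm y \<le> norm a"
    using continuous_attains_sup[of "cball x d" norm] d(1)
    by (metis cball_eq_empty compact_cball continuous_on_norm_id not_less_iff_gr_or_eq)
  have na: "norm a < 1" using a d by auto
  have "uniformly_convergent_on (cball x d)
      (\<lambda>N x. \<Prod>k<N. 1 - of_nat (num_partitions (Suc k)) * x ^ Suc k)"
  proof (rule uniformly_convergent_on_prod')
    show "uniformly_convergent_on (cball x d)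
        (\<lambda>N x. \<Sum>k<N. norm ((1 - of_nat (num_partitions (Suc k)) * x ^ Suc k) - 1 :: complex))"
    proof (rule Weierstrass_m_test')
      show "summable (\<lambda>k. real (num_partitions (Suc k)) * norm a ^ Suc k)"
        using summable_num_partitions[of "norm a"] na by (subst summable_Suc_iff) auto
      fix k y assume "y \<in> cball x d"
      then have "norm y ^ Suc k \<le> norm a ^ Suc k" by (intro power_mono a) auto
      then show "norm (norm (1 - of_nat (num_partitions (Suc k)) * y ^ Suc k - 1 :: complex))
          \<le> real (num_partitions (Suc k)) * norm a ^ Suc k"
        by (simp add: norm_mult norm_power mult_left_mono del: power_Suc)
    qed
  qed (auto intro!: continuous_intros)
  then obtain g where g: "uniform_limit (cball x d)
      (\<lambda>N x. \<Prod>k<N. 1 - of_nat (num_partitions (Suc k)) * x ^ Suc k) g sequentially"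
    by (auto simp: uniformly_convergent_on_def)
  have "g y = recip_Z y" if y: "y \<in> cball x d" for y
  proof (rule LIMSEQ_unique)
    show "(\<lambda>N. \<Prod>k<N. 1 - of_nat (num_partitions (Suc k)) * y ^ Suc k) \<longlonglongrightarrow> g y"
      by (rule tendsto_uniform_limitI[OF g y])
    have "norm y < 1" using y d by auto
    then show "(\<lambda>N. \<Prod>k<N. 1 - of_nat (num_partitions (Suc k)) * y ^ Suc k) \<longlonglongrightarrow> recip_Z y"
      unfolding recip_Z_def LIMSEQ_lessThan_iff_atMost
      by (intro convergent_prod_LIMSEQ convergent_prod_recip_Z)
  qed
  with g have "uniform_limit (cball x d)
      (\<lambda>N x. \<Prod>k<N. 1 - of_nat (num_partitions (Suc k)) * x ^ Suc k) recip_Z sequentially"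
    by (metis (mono_tags, lifting) uniform_limit_cong')
  then show "\<exists>d>0. cball x d \<subseteq> ball 0 1 \<and> uniform_limit (cball x d)
      (\<lambda>N x. \<Prod>k<N. 1 - of_nat (num_partitions (Suc k)) * x ^ Suc k) recip_Z sequentially"
    using d by blast
qed (auto intro!: holomorphic_intros)

lemma meromorphic_gen_fun_Z: "gen_fun_Z meromorphic_on ball 0 1"
proof -
  have "(\<lambda>x. inverse (recip_Z x)) meromorphic_on ball 0 1"
    by (intro meromorphic_on_inverse analytic_on_imp_meromorphic_on)
       (simp add: analytic_on_open holomorphic_recip_Z)
  moreover have "\<forall>\<^sub>\<approx>x\<in>ball 0 1. gen_fun_Z x = inverse (recip_Z x)"
    by (rule eventually_mono[OF eventually_in_cosparse[of "ball 0 1" "ball 0 1"]])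
       (auto simp: gen_fun_Z_eq_inverse_recip_Z)
  ultimately show ?thesis by (simp cong: meromorphic_on_cong')
qed

text \<open>
  Zeros of \<open>recip_Z\<close> are isolated because \<open>recip_Z 0 = 1\<close>.  Every factor of the original product
  has constant numerator, so nothing can cancel such a zero of the denominator.
\<close>

lemma is_pole_gen_fun_Z:
  assumes z: "norm z < 1" and "recip_Z z = 0"
  shows "is_pole gen_fun_Z z"
proof -
  have "\<forall>\<^sub>F w in at z. recip_Z w \<noteq> 0 \<and> w \<in> ball 0 1"
    by (rule non_zero_neighbour_alt[OF holomorphic_recip_Z, of z 0])
       (use z in \<open>auto simp: recip_Z_0\<close>)
  moreover have "recip_Z \<midarrow>z\<rightarrow> recip_Z z"
    using holomorphic_on_imp_continuous_on[OF holomorphic_recip_Z] z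
    by (simp add: continuous_on_eq_continuous_at isCont_def)
  ultimately have "isolated_zero recip_Z z"
    using assms by (auto simp: isolated_zero_def elim: eventually_mono)
  then have "is_pole (\<lambda>w. inverse (recip_Z w)) z"
    by (rule isolated_zero_imp_pole_inverse)
  moreover have "\<forall>\<^sub>F w in at z. gen_fun_Z w = inverse (recip_Z w)"
    using \<open>\<forall>\<^sub>F w in at z. recip_Z w \<noteq> 0 \<and> w \<in> ball 0 1\<close>
    by eventually_elim (auto simp: gen_fun_Z_eq_inverse_recip_Z)
  ultimately show ?thesis using is_pole_cong[OF _ refl] by metis
qed

section \<open>Accumulation of poles at the unit circle\<close>

text \<open>
  Approximate the direction of \<open>w\<close> by the \<open>k\<close>-th root of unity whose argument is obtained by
  rounding down; the moduli of the zeros of the \<open>k\<close>-th factor tend to \<open>1\<close> because for any \<open>r < 1\<close>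
  the terms \<open>p(k) r^k\<close> of a convergent series are eventually below \<open>1\<close>.
\<close>

lemma zeros_accumulate_at_circle:
  fixes w :: complex
  assumes w: "norm w = 1"
  shows "\<exists>z. (\<forall>n. norm (z n) < 1 \<and> recip_Z (z n) = 0) \<and> z \<longlonglongrightarrow> w"
proof -
  obtain t where t: "w = cis (2 * pi * t)"
  proof
    have "w \<noteq> 0" using w by auto
    then show "w = cis (2 * pi * (Arg w / (2 * pi)))"
      using w by (simp add: cis_Arg sgn_eq)
  qed
  \<comment> \<open>the first factor vanishes only at \<open>1\<close>, on the circle itself, so \<open>k\<close> starts at \<open>2\<close>\<close>
  define k :: "nat \<Rightarrow> nat" where "k = (\<lambda>n. n + 2)"
  define \<rho> where "\<rho> = (\<lambda>n. root (k n) (1 / real (num_partitions (k n))))"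
  define s where "s = (\<lambda>n. real_of_int \<lfloor>t * real (k n)\<rfloor> / real (k n))"
  define z where "z = (\<lambda>n. complex_of_real (\<rho> n) * cis (2 * pi * s n))"
  have k: "k n > 0" "num_partitions (k n) \<ge> 2" for n
    using num_partitions_ge_2[of "k n"] by (auto simp: k_def)
  have \<rho>_pow: "\<rho> n ^ k n = 1 / real (num_partitions (k n))" for n
    unfolding \<rho>_def using k[of n] by (intro real_root_pow_pos2) auto
  have \<rho>: "\<rho> n \<ge> 0" "\<rho> n < 1" for n
    using k[of n] by (auto simp: \<rho>_def real_root_ge_zero)
  have "norm (z n) < 1" for n
    using \<rho>[of n] by (simp add: z_def norm_mult)
  moreover have "recip_Z (z n) = 0" for n
  proof -
    have "cis (2 * pi * s n) ^ k n = cis (2 * pi * real_of_int \<lfloor>t * real (k n)\<rfloor>)"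
      unfolding Complex.DeMoivre by (rule arg_cong[of _ _ cis]) (use k(1)[of n] in \<open>simp add: s_def\<close>)
    also have "\<dots> = 1" by (rule cis_multiple_2pi) auto
    finally have "z n ^ k n = complex_of_real (1 / real (num_partitions (k n)))"
      by (simp add: z_def power_mult_distrib \<rho>_pow flip: of_real_power)
    then have "of_nat (num_partitions (k n)) * z n ^ k n = 1"
      using k[of n] by simp
    then show ?thesis
      using k[of n] \<open>norm (z n) < 1\<close> by (auto simp: recip_Z_eq_0_iff)
  qed
  moreover have "z \<longlonglongrightarrow> w"
  proof -
    have "\<rho> \<longlonglongrightarrow> 1"
    proof (rule order_tendstoI)
      fix a :: real assume "a < 1"
      define r where "r = max a 0"
      have r: "0 \<le> r" "r < 1" using \<open>a < 1\<close> by (auto simp: r_def)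
      have "(\<lambda>k. real (num_partitions k) * r ^ k) \<longlonglongrightarrow> 0"
        by (intro summable_LIMSEQ_zero summable_num_partitions r)
      then have "(\<lambda>n. real (num_partitions (k n)) * r ^ k n) \<longlonglongrightarrow> 0"
        unfolding k_def by (rule LIMSEQ_ignore_initial_segment)
      then have "\<forall>\<^sub>F n in sequentially. real (num_partitions (k n)) * r ^ k n < 1"
        by (rule order_tendstoD) simp
      then show "\<forall>\<^sub>F n in sequentially. a < \<rho> n"
      proof eventually_elim
        case (elim n)
        then have "r ^ k n < \<rho> n ^ k n"
          using k[of n] by (simp add: \<rho>_pow field_simps)
        then have "r < \<rho> n" by (rule power_less_imp_less_base) (rule \<rho>)
        then show ?case by (simp add: r_def)
      qed
    next
      fix a :: real assume "1 < a"
      then show "\<forall>\<^sub>F n in sequentially. \<rho> n < a"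
        using \<rho>(2) by (intro always_eventually allI) (meson less_trans)
    qed
    moreover have "s \<longlonglongrightarrow> t"
    proof (rule real_tendsto_sandwich)
      have "(\<lambda>n. inverse (real (k n))) \<longlonglongrightarrow> 0"
        unfolding k_def by (rule LIMSEQ_ignore_initial_segment[OF lim_inverse_n])
      then show "(\<lambda>n. t - inverse (real (k n))) \<longlonglongrightarrow> t"
        using tendsto_diff[OF tendsto_const] by fastforce
      have "t - inverse (real (k n)) \<le> s n" "s n \<le> t" for n
      proof -
        have "(t * real (k n) - 1) / real (k n) \<le> s n" "s n \<le> t * real (k n) / real (k n)"
          unfolding s_def by (rule divide_right_mono; linarith)+
        then show "t - inverse (real (k n)) \<le> s n" "s n \<le> t"
          using k(1)[of n] by (simp_all add: diff_divide_distrib inverse_eq_divide)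
      qed
      then show "\<forall>\<^sub>F n in sequentially. t - inverse (real (k n)) \<le> s n"
        "\<forall>\<^sub>F n in sequentially. s n \<le> t" by auto
    qed auto
    ultimately have "z \<longlonglongrightarrow> complex_of_real 1 * cis (2 * pi * t)"
      unfolding z_def cis_conv_exp by (intro tendsto_intros)
    then show ?thesis by (simp add: t)
  qed
  ultimately show ?thesis by blast
qed

theorem theorem10p1:
  shows "gen_fun_Z meromorphic_on ball 0 1 \<and>
    \<not> (\<exists>U g. open U \<and> connected U \<and> ball 0 1 \<subset> U \<and> g meromorphic_on U \<and>
          (\<forall>\<^sub>\<approx>x\<in>ball 0 1. g x = gen_fun_Z x))"
proof (intro conjI notI meromorphic_gen_fun_Z)
  assume "\<exists>U g. open U \<and> connected U \<and> ball 0 1 \<subset> U \<and> g meromorphic_on U \<and>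
          (\<forall>\<^sub>\<approx>x\<in>ball 0 1. g x = gen_fun_Z x)"
  then obtain U :: "complex set" and g where U: "open U" "connected U" "ball 0 1 \<subset> U"
    and g: "g meromorphic_on U" "\<forall>\<^sub>\<approx>x\<in>ball 0 1. g x = gen_fun_Z x" by blast
  have "U \<inter> frontier (ball 0 1) \<noteq> {}"
  proof (rule connected_Int_frontier[OF U(2)])
    show "U \<inter> ball 0 1 \<noteq> {}" using U(3) centre_in_ball[of "0::complex" 1] by fastforce
  qed (use U(3) in blast)
  then obtain w where w: "w \<in> U" "norm w = 1" by auto
  then obtain z where z: "\<And>n. norm (z n) < 1" "\<And>n. recip_Z (z n) = 0" "z \<longlonglongrightarrow> w"
    using zeros_accumulate_at_circle by metis
  have pole: "is_pole g (z n)" for n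
  proof -
    have "\<forall>\<^sub>F x in at (z n). g x = gen_fun_Z x"
      using eventually_cosparse_imp_eventually_at[OF g(2)] z(1)[of n] by simp
    then show ?thesis
      using is_pole_cong[of g gen_fun_Z] is_pole_gen_fun_Z[OF z(1,2)] by blast
  qed
  have "\<forall>\<^sub>F x in at w. \<not> is_pole g x"
    using eventually_cosparse_imp_eventually_at[OF meromorphic_on_imp_not_pole_cosparse[OF g(1)] w(1)] .
  \<comment> \<open>the \<open>z n\<close> have modulus below \<open>1\<close>, so they approach \<open>w\<close> without meeting it\<close>
  moreover have "filterlim z (at w) sequentially"
    using z w(2) by (intro filterlim_atI) (auto intro!: always_eventually, metis less_irrefl)
  ultimately have "\<forall>\<^sub>F n in sequentially. \<not> is_pole g (z n)"
    unfolding filterlim_iff by blast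
  with pole show False by simp
qed

end
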